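(* Let $(\mathrm{D.A},\mathbb{HA})$ be any of the pairs ($\mathrm{D.TQBA}$, htqBa), ($\mathrm{D.TQBA5}$, htqBa5), ($\mathrm{D.IA1}$, hIA1), ($\mathrm{D.IA2}$, hIA2), ($\mathrm{D.IA3}$, hIA3), ($\mathrm{D.PRA}$, hpra). Then the rules of $\mathrm{D.A}$ are sound with respect to the perfect elements of $\mathbb{HA}$: for every rule of $\mathrm{D.A}$ and every perfect $\mathbb{H}\in\mathbb{HA}$, the quasi-inequality obtained by interpreting sequents as inequalities and the rule as the implication from its premises to its conclusion, universally quantified over all values of the variables, is valid in $\mathbb{H}$.
   Context: **Heterogeneous algebras.** A heterogeneous tqBa (htqBa) is a tuple $\mathbb{H}=(\mathbb{D},\mathbb{L}_I,\mathbb{L}_C,e_I,e_C,\iota,\gamma)$ such that: (H1) $\mathbb{D}=(D,\lor,\land,\neg,\top,\bot)$ is a De Morgan algebra (bounded distributive lattice with an order-reversing involution $\neg$); (H2) $\mathbb{L}_I=(L_I,\cup,\cap,0_I,1_I)$ and $\mathbb{L}_C=(L_C,\sqcup,\sqcap,0_C,1_C)$ are bounded distributive lattices; (H3) $e_I:\mathbb{L}_I\hookrightarrow\mathbb{D}$ and $e_C:\mathbb{L}_C\hookrightarrow\mathbb{D}$ are homomorphisms of bounded lattices; (H4) $\iota:D\to L_I$ and $\gamma:D\to L_C$ satisfy $\iota(a\land b)=\iota(a)\cap\iota(b)$, $\iota(\top)=1_I$, $\iota(\bot)=0_I$, $\gamma(a\lor b)=\gamma(a)\sqcup\gamma(b)$,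 $\gamma(\top)=1_C$, $\gamma(\bot)=0_C$; (H5) $e_I\dashv\iota$ (i.e. $e_I(\alpha)\le a$ iff $\alpha\le\iota(a)$), $\gamma\dashv e_C$ (i.e. $\gamma(a)\le\xi$ iff $a\le e_C(\xi)$), $\iota(e_I(\alpha))=\alpha$, $\gamma(e_C(\xi))=\xi$; (H6) $e_C(\gamma(a))=\neg e_I(\iota(\neg a))$. Further conditions: (H7) $\mathbb{L}_I=\mathbb{L}_C=\mathbb{L}$ is a De Morgan algebra and $e_I=e_C=e$ is a De Morgan homomorphism; (H8) $\mathbb{L}$ is a Boolean algebra; (H9) $\iota(a\lor b)=\iota(a)\cup\iota(b)$; (H10) $\iota(a)\le\iota(b)$ and $\gamma(a)\le\gamma(b)$ imply $a\le b$. An htqBa is an htqBa5 if H7 holds; hIA1 if H7, H8; hIA2 if H7, H9; hIA3 if H7, H10; hpra if H7, H8, H9, H10. $\mathbb{H}$ is perfect if every distributive lattice (expansion) in its signature is perfect (the lattice is complete, completely distributive and completely join-generated by its completely join-irreducible elements) and every join (resp. meet) preserving map in its signature is completely join (resp. meet) preserving. In a perfect $\mathbb{H}$, $e_I$ has a left adjoint $\iota':\mathbb{D}\to\mathbb{L}_I$ and $e_C$ has a right adjoint $\gamma':\mathbb{D}\to\mathbb{L}_C$. **Language of the display calculi.** Three types $\mathsf{D},\mathsf{K}_I,\mathsf{K}_C$. Formulas: $\mathsf{D}$: $A::=p\mid\top\mid\bot\mid\circ_I\alpha\mid\circ_C\xi\mid\neg A\mid A\land A\mid A\lor A$ ($p$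 a propositional variable); $\mathsf{K}_I$: $\alpha::=\blacksquare_I A\mid 1_I\mid 0_I\mid\alpha\cap\alpha\mid\alpha\cup\alpha\mid(\sim\alpha)$; $\mathsf{K}_C$: $\xi::=◆_C A\mid 1_C\mid 0_C\mid\xi\sqcap\xi\mid\xi\sqcup\xi\mid(-\xi)$. Structures (structural connectives carry $\hat{\ },\check{\ },\tilde{\ }$): $X::=A\mid\check\bot\mid\hat\top\mid\tilde\circ_C\Pi\mid\tilde\circ_I\Gamma\mid\tilde\neg X\mid X\,\hat\land\,X\mid X\,\check\lor\,X\mid X\,\hat\succ\,X\mid X\,\check\to\,X$; $\Gamma::=\alpha\mid\check\blacksquare_I X\mid\hat{◆}_I X\mid\check 0_I\mid\hat 1_I\mid\Gamma\,\hat\cap\,\Gamma\mid\Gamma\,\check\cup\,\Gamma\mid\Gamma\,\hat\succ_I\,\Gamma\mid\Gamma\,\check\to_I\,\Gamma\mid(\tilde\sim\Gamma)$; $\Pi::=\xi\mid\hat{◆}_C X\mid\check\blacksquare_C X\mid\check 0_C\mid\hat 1_C\mid\Pi\,\hat\sqcap\,\Pi\mid\Pi\,\check\sqcup\,\Pi\mid\Pi\,\hat\succ_C\,\Pi\mid\Pi\,\check\to_C\,\Pi\mid(\tilde-\Pi)$. Items in round brackets belong only to $\mathrm{D.TQBA5}$ and its extensions. Sequents relate two structures of the same type. Variables: $X,Y,Z,W$ of type $\mathsf{D}$; $\Gamma,\Delta,\Lambda$ of type $\mathsf{K}_I$; $\Pi,\Sigma,\Omega$ of type $\mathsf{K}_C$.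 Below "$S\,/\,S'$" means from $S$ infer $S'$, and "$S\,/\!/\,S'$" means the rule can be applied in both directions (giving two rules). **Interpretation.** In a perfect $\mathbb{H}$, type $\mathsf{D}$ is interpreted in $\mathbb{D}$, $\mathsf{K}_I$ in $\mathbb{L}_I$, $\mathsf{K}_C$ in $\mathbb{L}_C$. Pure-type logical connectives are interpreted as the corresponding operations; $\sim$ and $-$ (when present) as the negation of $\mathbb{L}$; $\circ_I,\circ_C,\blacksquare_I,◆_C$ as $e_I,e_C,\iota,\gamma$. Each structural connective is interpreted as the logical connective it decorates, with $\hat{◆}_I$ interpreted as $\iota'$, $\check\blacksquare_C$ as $\gamma'$, $\check\to,\check\to_I,\check\to_C$ as the right residual of meet ($x\wedge y\le z$ iff $y\le x\to z$) and $\hat\succ,\hat\succ_I,\hat\succ_C$ as the left residual of join ($x\le y\vee z$ iff $y\succ x\le z$) in the respective lattice. $\vdash$ is interpreted as $\le$, and formula and structure variables as arbitrary elements of the appropriate type. **Rules of $\mathrm{D.TQBA}$.** - Identity $p\vdash p$. Cut in each type: $X\vdash A$ and $A\vdash Y$ / $X\vdash Y$; $\Gamma\vdash\alpha$ and $\alpha\vdash\Delta$ / $\Gamma\vdash\Delta$; $\Pi\vdash\xi$ and $\xi\vdash\Sigma$ / $\Pi\vdash\Sigma$. - Pure display rules: $X\,\hat\land\,Y\vdash Z$ // $Y\vdash X\,\check\to\,Z$; $X\vdash Y\,\check\lor\,Z$ // $Y\,\hat\succ\,X\vdash Z$; $\tilde\neg X\vdash Y$ // $\tilde\neg Y\vdash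 X$; $X\vdash\tilde\neg Y$ // $Y\vdash\tilde\neg X$; $\Gamma\,\hat\cap\,\Delta\vdash\Lambda$ // $\Delta\vdash\Gamma\,\check\to_I\,\Lambda$; $\Gamma\vdash\Delta\,\check\cup\,\Lambda$ // $\Delta\,\hat\succ_I\,\Gamma\vdash\Lambda$; $\Pi\,\hat\sqcap\,\Sigma\vdash\Omega$ // $\Sigma\vdash\Pi\,\check\to_C\,\Omega$; $\Pi\vdash\Sigma\,\check\sqcup\,\Omega$ // $\Sigma\,\hat\succ_C\,\Pi\vdash\Omega$. - Multi-type display rules: $\tilde\circ_I\Gamma\vdash Y$ // $\Gamma\vdash\check\blacksquare_I Y$; $Y\vdash\tilde\circ_I\Gamma$ // $\hat{◆}_I Y\vdash\Gamma$; $Y\vdash\tilde\circ_C\Pi$ // $\hat{◆}_C Y\vdash\Pi$; $\tilde\circ_C\Pi\vdash X$ // $\Pi\vdash\check\blacksquare_C X$. - Pure structural rules: in each type, standard weakening, contraction, commutativity and associativity, for the structural conjunction ($\hat\land,\hat\cap,\hat\sqcap$) on the left of $\vdash$ and the structural disjunction ($\check\lor,\check\cup,\check\sqcup$) on the right; $X\vdash Y$ // $\tilde\neg Y\vdash\tilde\neg X$; $X\vdash Y$ // $X\,\hat\land\,\hat\top\vdash Y$; $X\vdash Y$ // $X\vdash Y\,\check\lor\,\check\bot$; and likewise for $(\hat\cap,\hat 1_I)$, $(\check\cup,\check 0_I)$, $(\hat\sqcap,\hat 1_C)$, $(\check\sqcup,\check 0_C)$. - Multi-type structural rules: $\hat\top\vdash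 Y$ // $\tilde\circ_I\hat 1_I\vdash Y$; $\Gamma\vdash\check\blacksquare_I\check\bot$ // $\Gamma\vdash\check 0_I$; $\hat{◆}_C\hat\top\vdash\Pi$ // $\hat 1_C\vdash\Pi$; $X\vdash\check\bot$ // $X\vdash\tilde\circ_C\check 0_C$; $\tilde\circ_I\Gamma\vdash\tilde\circ_I\Delta$ // $\Gamma\vdash\Delta$; $\tilde\circ_C\Pi\vdash\tilde\circ_C\Sigma$ // $\Pi\vdash\Sigma$; $\hat{◆}_C X\vdash\check\blacksquare_C Y$ / $X\vdash Y$; $\hat{◆}_I X\vdash\check\blacksquare_I Y$ / $X\vdash Y$; $X\vdash\tilde\circ_I\check\blacksquare_I\tilde\neg Y$ // $X\vdash\tilde\neg\tilde\circ_C\hat{◆}_C Y$; $X\vdash\tilde\circ_C\check\blacksquare_C\tilde\neg Y$ // $X\vdash\tilde\neg\tilde\circ_I\hat{◆}_I Y$; $\tilde\circ_C\hat{◆}_C\tilde\neg X\vdash Y$ // $\tilde\neg\tilde\circ_I\check\blacksquare_I X\vdash Y$; $\tilde\circ_I\hat{◆}_I\tilde\neg X\vdash Y$ // $\tilde\neg\tilde\circ_C\check\blacksquare_C X\vdash Y$. - Operational rules for pure-type connectives (standard): $\hat\top\vdash\top$; $\hat\top\vdash X$ / $\top\vdash X$; $\bot\vdash\check\bot$; $X\vdash\check\bot$ / $X\vdash\bot$; $A\,\hat\land\,B\vdash X$ / $A\land B\vdash X$; $X\vdash A$ and $Y\vdash B$ / $X\,\hat\land\,Y\vdash A\land B$;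 $A\vdash X$ and $B\vdash Y$ / $A\lor B\vdash X\,\check\lor\,Y$; $X\vdash A\,\check\lor\,B$ / $X\vdash A\lor B$; $\tilde\neg A\vdash X$ / $\neg A\vdash X$; $X\vdash\tilde\neg A$ / $X\vdash\neg A$; and likewise for $1_I,0_I,\cap,\cup$ and $1_C,0_C,\sqcap,\sqcup$. - Operational rules for multi-type connectives: $\Gamma\vdash\check\blacksquare_I A$ / $\Gamma\vdash\blacksquare_I A$; $A\vdash X$ / $\blacksquare_I A\vdash\check\blacksquare_I X$; $\hat{◆}_C A\vdash\Pi$ / $◆_C A\vdash\Pi$; $X\vdash A$ / $\hat{◆}_C X\vdash ◆_C A$; $X\vdash\tilde\circ_I\alpha$ / $X\vdash\circ_I\alpha$; $\tilde\circ_I\alpha\vdash X$ / $\circ_I\alpha\vdash X$; $X\vdash\tilde\circ_C\xi$ / $X\vdash\circ_C\xi$; $\tilde\circ_C\xi\vdash X$ / $\circ_C\xi\vdash X$. **$\mathrm{D.TQBA5}$** adds: $\tilde\sim\Gamma\vdash\Delta$ // $\tilde\sim\Delta\vdash\Gamma$; $\Gamma\vdash\tilde\sim\Delta$ // $\Delta\vdash\tilde\sim\Gamma$; $\tilde-\Pi\vdash\Sigma$ // $\tilde-\Sigma\vdash\Pi$; $\Pi\vdash\tilde-\Sigma$ // $\Sigma\vdash\tilde-\Pi$; $\Gamma\vdash\Delta$ // $\tilde\sim\Delta\vdash\tilde\sim\Gamma$; $\Pi\vdash\Sigma$ // $\tilde-\Sigma\vdash\tilde-\Pi$; $X\vdash\tilde\circ_I\check\blacksquare_I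 Y$ // $X\vdash\tilde\circ_C\check\blacksquare_C Y$; $X\vdash\tilde\circ_I\tilde\sim\Gamma$ / $X\vdash\tilde\neg\tilde\circ_I\Gamma$; $X\vdash\tilde\circ_C\tilde-\Pi$ / $X\vdash\tilde\neg\tilde\circ_C\Pi$; and operational rules $\Gamma\vdash\tilde\sim\alpha$ / $\Gamma\vdash\sim\alpha$; $\tilde\sim\alpha\vdash\Gamma$ / $\sim\alpha\vdash\Gamma$; $\Pi\vdash\tilde-\xi$ / $\Pi\vdash-\xi$; $\tilde-\xi\vdash\Pi$ / $-\xi\vdash\Pi$. **Extensions of $\mathrm{D.TQBA5}$.** $\mathrm{D.IA1}$ adds (cgri): $\Gamma\,\hat\cap\,\Delta\vdash\Lambda$ / $\Delta\vdash\tilde\sim\Gamma\,\check\cup\,\Lambda$ and $\Pi\,\hat\sqcap\,\Sigma\vdash\Omega$ / $\Sigma\vdash\tilde-\Pi\,\check\sqcup\,\Omega$. $\mathrm{D.IA2}$ adds $\Gamma\vdash\check\blacksquare_I(X\,\check\lor\,Y)$ / $\Gamma\vdash\check\blacksquare_I X\,\check\cup\,\check\blacksquare_I Y$ and $\hat{◆}_C(X\,\hat\land\,Y)\vdash\Pi$ / $\hat{◆}_C X\,\hat\sqcap\,\hat{◆}_C Y\vdash\Pi$. $\mathrm{D.IA3}$ adds (ia3): $X\vdash Y$ and $W\vdash Z$ / $X\,\hat\land\,\tilde\circ_C\hat{◆}_C W\vdash\tilde\circ_I\check\blacksquare_I Y\,\check\lor\,Z$. $\mathrm{D.PRA}$ adds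 all the rules of $\mathrm{D.IA1}$, $\mathrm{D.IA2}$ and $\mathrm{D.IA3}$. *)

theory Defs
  imports Main
begin

unbundle lattice_syntax

section \<open>Heterogeneous algebras\<close>

text \<open>
  The lattice reducts of \<open>\<bbbD>\<close>, \<open>\<bbbL>\<^sub>I\<close> and \<open>\<bbbL>\<^sub>C\<close> are given by the type classes of \<open>'d\<close>, \<open>'i\<close> and \<open>'c\<close>;
  the remaining operations form a record. The fields \<open>neg_I\<close> and \<open>neg_C\<close> interpret the negations
  of \<open>\<bbbL>\<close>. They belong to the signature only under (H7): \<open>htqBa\<close> does not constrain them, and no rule
  in \<open>rules_TQBA\<close> mentions the connectives they interpret. Under (H7), \<open>\<bbbL>\<^sub>I = \<bbbL>\<^sub>C\<close> is expressed by
  \<open>'i = 'c\<close>.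
\<close>

record ('d, 'i, 'c) halg =
  neg_D :: "'d \<Rightarrow> 'd"
  neg_I :: "'i \<Rightarrow> 'i"
  neg_C :: "'c \<Rightarrow> 'c"
  emb_I :: "'i \<Rightarrow> 'd"
  emb_C :: "'c \<Rightarrow> 'd"
  iota :: "'d \<Rightarrow> 'i"
  gamma :: "'d \<Rightarrow> 'c"

definition de_morgan :: "('a::{bounded_lattice,distrib_lattice} \<Rightarrow> 'a) \<Rightarrow> bool" where
  "de_morgan n \<longleftrightarrow> (\<forall>a b. a \<le> b \<longrightarrow> n b \<le> n a) \<and> (\<forall>a. n (n a) = a)"

definition bounded_lattice_hom :: "('a::bounded_lattice \<Rightarrow> 'b::bounded_lattice) \<Rightarrow> bool" where
  "bounded_lattice_hom h \<longleftrightarrow>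
     (\<forall>a b. h (a \<squnion> b) = h a \<squnion> h b) \<and> (\<forall>a b. h (a \<sqinter> b) = h a \<sqinter> h b) \<and> h \<top> = \<top> \<and> h \<bottom> = \<bottom>"

definition htqBa ::
  "('d::{bounded_lattice,distrib_lattice}, 'i::{bounded_lattice,distrib_lattice},
    'c::{bounded_lattice,distrib_lattice}) halg \<Rightarrow> bool" where
  "htqBa H \<longleftrightarrow>
     de_morgan (neg_D H) \<and>
     bounded_lattice_hom (emb_I H) \<and> bounded_lattice_hom (emb_C H) \<and>
     (\<forall>a b. iota H (a \<sqinter> b) = iota H a \<sqinter> iota H b) \<and> iota H \<top> = \<top> \<and> iota H \<bottom> = \<bottom> \<and>
     (\<forall>a b. gamma H (a \<squnion> b) = gamma H a \<squnion> gamma H b) \<and> gamma H \<top> = \<top> \<and> gamma H \<bottom> = \<bottom> \<and>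
     (\<forall>\<alpha> a. emb_I H \<alpha> \<le> a \<longleftrightarrow> \<alpha> \<le> iota H a) \<and>
     (\<forall>a \<xi>. gamma H a \<le> \<xi> \<longleftrightarrow> a \<le> emb_C H \<xi>) \<and>
     (\<forall>\<alpha>. iota H (emb_I H \<alpha>) = \<alpha>) \<and> (\<forall>\<xi>. gamma H (emb_C H \<xi>) = \<xi>) \<and>
     (\<forall>a. emb_C H (gamma H a) = neg_D H (emb_I H (iota H (neg_D H a))))"

definition H7 :: "('d::{bounded_lattice,distrib_lattice}, 'l::{bounded_lattice,distrib_lattice}, 'l) halg \<Rightarrow> bool" where
  "H7 H \<longleftrightarrow>
     neg_I H = neg_C H \<and> de_morgan (neg_I H) \<and>
     emb_I H = emb_C H \<and> bounded_lattice_hom (emb_I H) \<and>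
     (\<forall>\<alpha>. emb_I H (neg_I H \<alpha>) = neg_D H (emb_I H \<alpha>))"

text \<open>The Boolean complement in (H8) is the negation of \<open>\<bbbL>\<close>, not some other operation.\<close>

definition H8 :: "('d, 'l::{bounded_lattice,distrib_lattice}, 'l) halg \<Rightarrow> bool" where
  "H8 H \<longleftrightarrow> abstract_boolean_algebra (\<sqinter>) (\<squnion>) (neg_I H) \<bottom> \<top>"

definition H9 :: "('d::lattice, 'l::lattice, 'l) halg \<Rightarrow> bool" where
  "H9 H \<longleftrightarrow> (\<forall>a b. iota H (a \<squnion> b) = iota H a \<squnion> iota H b)"

definition H10 :: "('d::lattice, 'l::lattice, 'l) halg \<Rightarrow> bool" where
  "H10 H \<longleftrightarrow> (\<forall>a b. iota H a \<le> iota H b \<and> gamma H a \<le> gamma H b \<longrightarrow> a \<le> b)"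

definition htqBa5 :: "('d::{bounded_lattice,distrib_lattice}, 'l::{bounded_lattice,distrib_lattice}, 'l) halg \<Rightarrow> bool" where
  "htqBa5 H \<longleftrightarrow> htqBa H \<and> H7 H"

definition hIA1 :: "('d::{bounded_lattice,distrib_lattice}, 'l::{bounded_lattice,distrib_lattice}, 'l) halg \<Rightarrow> bool" where
  "hIA1 H \<longleftrightarrow> htqBa H \<and> H7 H \<and> H8 H"

definition hIA2 :: "('d::{bounded_lattice,distrib_lattice}, 'l::{bounded_lattice,distrib_lattice}, 'l) halg \<Rightarrow> bool" where
  "hIA2 H \<longleftrightarrow> htqBa H \<and> H7 H \<and> H9 H"

definition hIA3 :: "('d::{bounded_lattice,distrib_lattice}, 'l::{bounded_lattice,distrib_lattice}, 'l) halg \<Rightarrow> bool" where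
  "hIA3 H \<longleftrightarrow> htqBa H \<and> H7 H \<and> H10 H"

definition hpra :: "('d::{bounded_lattice,distrib_lattice}, 'l::{bounded_lattice,distrib_lattice}, 'l) halg \<Rightarrow> bool" where
  "hpra H \<longleftrightarrow> htqBa H \<and> H7 H \<and> H8 H \<and> H9 H \<and> H10 H"

subsection \<open>Perfect algebras\<close>

definition completely_join_irreducible :: "'a::complete_lattice \<Rightarrow> bool" where
  "completely_join_irreducible j \<longleftrightarrow> (\<forall>S. j = \<Squnion>S \<longrightarrow> j \<in> S)"

text \<open>Completeness and complete distributivity are the class constraint.\<close>

definition perfect_lattice :: "'a::complete_distrib_lattice itself \<Rightarrow> bool" where
  "perfect_lattice _ \<longleftrightarrow> (\<forall>x::'a. x = \<Squnion>{j. completely_join_irreducible j \<and> j \<le> x})"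

definition join_pres :: "('a::lattice \<Rightarrow> 'b::lattice) \<Rightarrow> bool" where
  "join_pres f \<longleftrightarrow> (\<forall>a b. f (a \<squnion> b) = f a \<squnion> f b)"

definition meet_pres :: "('a::lattice \<Rightarrow> 'b::lattice) \<Rightarrow> bool" where
  "meet_pres f \<longleftrightarrow> (\<forall>a b. f (a \<sqinter> b) = f a \<sqinter> f b)"

definition completely_join_pres :: "('a::complete_lattice \<Rightarrow> 'b::complete_lattice) \<Rightarrow> bool" where
  "completely_join_pres f \<longleftrightarrow> (\<forall>S. f (\<Squnion>S) = \<Squnion>(f ` S))"

definition completely_meet_pres :: "('a::complete_lattice \<Rightarrow> 'b::complete_lattice) \<Rightarrow> bool" where
  "completely_meet_pres f \<longleftrightarrow> (\<forall>S. f (\<Sqinter>S) = \<Sqinter>(f ` S))"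

definition perfect_map :: "('a::complete_lattice \<Rightarrow> 'b::complete_lattice) \<Rightarrow> bool" where
  "perfect_map f \<longleftrightarrow>
     (join_pres f \<longrightarrow> completely_join_pres f) \<and> (meet_pres f \<longrightarrow> completely_meet_pres f)"

text \<open>
  The negations need no clause: an order-reversing involution turns arbitrary joins into meets and
  conversely. Complete distributivity covers the binary meets and joins.
\<close>

definition perfect ::
  "('d::complete_distrib_lattice, 'i::complete_distrib_lattice, 'c::complete_distrib_lattice) halg \<Rightarrow> bool" where
  "perfect H \<longleftrightarrow>
     perfect_lattice TYPE('d) \<and> perfect_lattice TYPE('i) \<and> perfect_lattice TYPE('c) \<and>
     perfect_map (emb_I H) \<and> perfect_map (emb_C H) \<and> perfect_map (iota H) \<and> perfect_map (gamma H)"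

section \<open>Syntax\<close>

text \<open>
  Rules are finite schemas, so besides the propositional variables \<open>PVar n\<close> the syntax has formula
  metavariables (\<open>FVar_D\<close>, \<open>FVar_I\<close>, \<open>FVar_C\<close>) and structure metavariables (\<open>SVar_D\<close>, \<open>SVar_I\<close>,
  \<open>SVar_C\<close>). The connectives \<open>Sim_I\<close>, \<open>Minus_C\<close>, \<open>tsim\<close>, \<open>tminus\<close> belong to D.TQBA5 and its extensions.
\<close>

datatype fm_D =
    PVar nat
  | FVar_D nat
  | Top_D
  | Bot_D
  | Circ_I fm_I
  | Circ_C fm_C
  | Neg_D fm_D
  | And_D fm_D fm_D
  | Or_D fm_D fm_D
and fm_I =
    FVar_I nat
  | BBox_I fm_D
  | One_I
  | Zero_I
  | Cap_I fm_I fm_I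
  | Cup_I fm_I fm_I
  | Sim_I fm_I
and fm_C =
    FVar_C nat
  | BDia_C fm_D
  | One_C
  | Zero_C
  | Cap_C fm_C fm_C
  | Cup_C fm_C fm_C
  | Minus_C fm_C

text \<open>
  Prefixes \<open>h\<close>, \<open>c\<close>, \<open>t\<close> stand for the hat, check and tilde of a structural connective; the binary
  symbols carry the type as a subscript instead.
\<close>

datatype str_D =
    fD fm_D
  | SVar_D nat
  | cbot
  | htop
  | tcirc_C str_C
  | tcirc_I str_I
  | tneg str_D
  | hand_D str_D str_D  (infixr \<open>\<and>\<^sub>D\<close> 70)
  | cor_D str_D str_D  (infixr \<open>\<or>\<^sub>D\<close> 65)
  | hcoimp_D str_D str_D  (infixr \<open>\<succ>\<^sub>D\<close> 60)
  | cimp_D str_D str_D  (infixr \<open>\<rightarrow>\<^sub>D\<close> 60)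
and str_I =
    fI fm_I
  | SVar_I nat
  | cbbox_I str_D
  | hbdia_I str_D
  | czero_I
  | hone_I
  | hcap_I str_I str_I  (infixr \<open>\<inter>\<^sub>I\<close> 70)
  | ccup_I str_I str_I  (infixr \<open>\<union>\<^sub>I\<close> 65)
  | hcoimp_I str_I str_I  (infixr \<open>\<succ>\<^sub>I\<close> 60)
  | cimp_I str_I str_I  (infixr \<open>\<rightarrow>\<^sub>I\<close> 60)
  | tsim str_I
and str_C =
    fC fm_C
  | SVar_C nat
  | hbdia_C str_D
  | cbbox_C str_D
  | czero_C
  | hone_C
  | hcap_C str_C str_C  (infixr \<open>\<sqinter>\<^sub>C\<close> 70)
  | ccup_C str_C str_C  (infixr \<open>\<squnion>\<^sub>C\<close> 65)
  | hcoimp_C str_C str_C  (infixr \<open>\<succ>\<^sub>C\<close> 60)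
  | cimp_C str_C str_C  (infixr \<open>\<rightarrow>\<^sub>C\<close> 60)
  | tminus str_C

datatype sequent =
    Seq_D str_D str_D  (infix \<open>\<turnstile>\<^sub>D\<close> 55)
  | Seq_I str_I str_I  (infix \<open>\<turnstile>\<^sub>I\<close> 55)
  | Seq_C str_C str_C  (infix \<open>\<turnstile>\<^sub>C\<close> 55)

datatype rule = Rule (prems: "sequent list") (concl: sequent)  (infix \<open>\<Longrightarrow>\<^sub>R\<close> 53)

definition both :: "sequent \<Rightarrow> sequent \<Rightarrow> rule set"  (infix \<open>\<Longleftrightarrow>\<^sub>R\<close> 53) where
  "S \<Longleftrightarrow>\<^sub>R S' = {[S] \<Longrightarrow>\<^sub>R S', [S'] \<Longrightarrow>\<^sub>R S}"

section \<open>Interpretation\<close>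

record ('d, 'i, 'c) valuation =
  val_p :: "nat \<Rightarrow> 'd"
  val_fD :: "nat \<Rightarrow> 'd"
  val_fI :: "nat \<Rightarrow> 'i"
  val_fC :: "nat \<Rightarrow> 'c"
  val_sD :: "nat \<Rightarrow> 'd"
  val_sI :: "nat \<Rightarrow> 'i"
  val_sC :: "nat \<Rightarrow> 'c"

text \<open>
  The residuals and adjoints are characterised by their defining equivalences; they are unique when
  they exist, which is the case in a perfect algebra.
\<close>

definition meet_residual :: "'a::lattice \<Rightarrow> 'a \<Rightarrow> 'a" where
  "meet_residual x z = (THE r. \<forall>y. x \<sqinter> y \<le> z \<longleftrightarrow> y \<le> r)"

definition join_residual :: "'a::lattice \<Rightarrow> 'a \<Rightarrow> 'a" where
  "join_residual y x = (THE r. \<forall>z. x \<le> y \<squnion> z \<longleftrightarrow> r \<le> z)"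

definition left_adjoint :: "('b::order \<Rightarrow> 'a::order) \<Rightarrow> 'a \<Rightarrow> 'b" where
  "left_adjoint e = (THE f. \<forall>a \<beta>. f a \<le> \<beta> \<longleftrightarrow> a \<le> e \<beta>)"

definition right_adjoint :: "('b::order \<Rightarrow> 'a::order) \<Rightarrow> 'a \<Rightarrow> 'b" where
  "right_adjoint e = (THE g. \<forall>\<beta> a. e \<beta> \<le> a \<longleftrightarrow> \<beta> \<le> g a)"

definition iota' :: "('d::order, 'i::order, 'c) halg \<Rightarrow> 'd \<Rightarrow> 'i" where
  "iota' H = left_adjoint (emb_I H)"

definition gamma' :: "('d::order, 'i, 'c::order) halg \<Rightarrow> 'd \<Rightarrow> 'c" where
  "gamma' H = right_adjoint (emb_C H)"

context
  fixes H :: "('d::bounded_lattice, 'i::bounded_lattice, 'c::bounded_lattice) halg"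
    and v :: "('d, 'i, 'c) valuation"
begin

primrec int_fD :: "fm_D \<Rightarrow> 'd" and int_fI :: "fm_I \<Rightarrow> 'i" and int_fC :: "fm_C \<Rightarrow> 'c" where
  "int_fD (PVar n) = val_p v n"
| "int_fD (FVar_D n) = val_fD v n"
| "int_fD Top_D = \<top>"
| "int_fD Bot_D = \<bottom>"
| "int_fD (Circ_I \<alpha>) = emb_I H (int_fI \<alpha>)"
| "int_fD (Circ_C \<xi>) = emb_C H (int_fC \<xi>)"
| "int_fD (Neg_D A) = neg_D H (int_fD A)"
| "int_fD (And_D A B) = int_fD A \<sqinter> int_fD B"
| "int_fD (Or_D A B) = int_fD A \<squnion> int_fD B"
| "int_fI (FVar_I n) = val_fI v n"
| "int_fI (BBox_I A) = iota H (int_fD A)"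
| "int_fI One_I = \<top>"
| "int_fI Zero_I = \<bottom>"
| "int_fI (Cap_I \<alpha> \<beta>) = int_fI \<alpha> \<sqinter> int_fI \<beta>"
| "int_fI (Cup_I \<alpha> \<beta>) = int_fI \<alpha> \<squnion> int_fI \<beta>"
| "int_fI (Sim_I \<alpha>) = neg_I H (int_fI \<alpha>)"
| "int_fC (FVar_C n) = val_fC v n"
| "int_fC (BDia_C A) = gamma H (int_fD A)"
| "int_fC One_C = \<top>"
| "int_fC Zero_C = \<bottom>"
| "int_fC (Cap_C \<xi> \<chi>) = int_fC \<xi> \<sqinter> int_fC \<chi>"
| "int_fC (Cup_C \<xi> \<chi>) = int_fC \<xi> \<squnion> int_fC \<chi>"
| "int_fC (Minus_C \<xi>) = neg_C H (int_fC \<xi>)"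

primrec int_D :: "str_D \<Rightarrow> 'd" and int_I :: "str_I \<Rightarrow> 'i" and int_C :: "str_C \<Rightarrow> 'c" where
  "int_D (fD A) = int_fD A"
| "int_D (SVar_D n) = val_sD v n"
| "int_D cbot = \<bottom>"
| "int_D htop = \<top>"
| "int_D (tcirc_C P) = emb_C H (int_C P)"
| "int_D (tcirc_I G) = emb_I H (int_I G)"
| "int_D (tneg X) = neg_D H (int_D X)"
| "int_D (X \<and>\<^sub>D Y) = int_D X \<sqinter> int_D Y"
| "int_D (X \<or>\<^sub>D Y) = int_D X \<squnion> int_D Y"
| "int_D (X \<succ>\<^sub>D Y) = join_residual (int_D X) (int_D Y)"
| "int_D (X \<rightarrow>\<^sub>D Y) = meet_residual (int_D X) (int_D Y)"
| "int_I (fI \<alpha>) = int_fI \<alpha>"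
| "int_I (SVar_I n) = val_sI v n"
| "int_I (cbbox_I X) = iota H (int_D X)"
| "int_I (hbdia_I X) = iota' H (int_D X)"
| "int_I czero_I = \<bottom>"
| "int_I hone_I = \<top>"
| "int_I (G \<inter>\<^sub>I D) = int_I G \<sqinter> int_I D"
| "int_I (G \<union>\<^sub>I D) = int_I G \<squnion> int_I D"
| "int_I (G \<succ>\<^sub>I D) = join_residual (int_I G) (int_I D)"
| "int_I (G \<rightarrow>\<^sub>I D) = meet_residual (int_I G) (int_I D)"
| "int_I (tsim G) = neg_I H (int_I G)"
| "int_C (fC \<xi>) = int_fC \<xi>"
| "int_C (SVar_C n) = val_sC v n"
| "int_C (hbdia_C X) = gamma H (int_D X)"
| "int_C (cbbox_C X) = gamma' H (int_D X)"
| "int_C czero_C = \<bottom>"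
| "int_C hone_C = \<top>"
| "int_C (P \<sqinter>\<^sub>C S) = int_C P \<sqinter> int_C S"
| "int_C (P \<squnion>\<^sub>C S) = int_C P \<squnion> int_C S"
| "int_C (P \<succ>\<^sub>C S) = join_residual (int_C P) (int_C S)"
| "int_C (P \<rightarrow>\<^sub>C S) = meet_residual (int_C P) (int_C S)"
| "int_C (tminus P) = neg_C H (int_C P)"

primrec holds :: "sequent \<Rightarrow> bool" where
  "holds (X \<turnstile>\<^sub>D Y) \<longleftrightarrow> int_D X \<le> int_D Y"
| "holds (G \<turnstile>\<^sub>I D) \<longleftrightarrow> int_I G \<le> int_I D"
| "holds (P \<turnstile>\<^sub>C S) \<longleftrightarrow> int_C P \<le> int_C S"

end

definition rule_valid ::
  "('d::bounded_lattice, 'i::bounded_lattice, 'c::bounded_lattice) halg \<Rightarrow> rule \<Rightarrow> bool" where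
  "rule_valid H R \<longleftrightarrow>
     (\<forall>v. (\<forall>S \<in> set (prems R). holds H v S) \<longrightarrow> holds H v (concl R))"

section \<open>The display calculi\<close>

text \<open>Bold letters are the metavariables of the rule schemas.\<close>

abbreviation mvX (\<open>\<^bold>X\<close>) where "\<^bold>X \<equiv> SVar_D 0"
abbreviation mvY (\<open>\<^bold>Y\<close>) where "\<^bold>Y \<equiv> SVar_D 1"
abbreviation mvZ (\<open>\<^bold>Z\<close>) where "\<^bold>Z \<equiv> SVar_D 2"
abbreviation mvW (\<open>\<^bold>W\<close>) where "\<^bold>W \<equiv> SVar_D 3"
abbreviation mvGamma (\<open>\<^bold>\<Gamma>\<close>) where "\<^bold>\<Gamma> \<equiv> SVar_I 0"
abbreviation mvDelta (\<open>\<^bold>\<Delta>\<close>) where "\<^bold>\<Delta> \<equiv> SVar_I 1"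
abbreviation mvLambda (\<open>\<^bold>\<Lambda>\<close>) where "\<^bold>\<Lambda> \<equiv> SVar_I 2"
abbreviation mvTheta (\<open>\<^bold>\<Theta>\<close>) where "\<^bold>\<Theta> \<equiv> SVar_I 3"
abbreviation mvPi (\<open>\<^bold>\<Pi>\<close>) where "\<^bold>\<Pi> \<equiv> SVar_C 0"
abbreviation mvSigma (\<open>\<^bold>\<Sigma>\<close>) where "\<^bold>\<Sigma> \<equiv> SVar_C 1"
abbreviation mvOmega (\<open>\<^bold>\<Omega>\<close>) where "\<^bold>\<Omega> \<equiv> SVar_C 2"
abbreviation mvPsi (\<open>\<^bold>\<Psi>\<close>) where "\<^bold>\<Psi> \<equiv> SVar_C 3"
abbreviation mvA (\<open>\<^bold>A\<close>) where "\<^bold>A \<equiv> FVar_D 0"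
abbreviation mvB (\<open>\<^bold>B\<close>) where "\<^bold>B \<equiv> FVar_D 1"
abbreviation mvalpha (\<open>\<^bold>\<alpha>\<close>) where "\<^bold>\<alpha> \<equiv> FVar_I 0"
abbreviation mvbeta (\<open>\<^bold>\<beta>\<close>) where "\<^bold>\<beta> \<equiv> FVar_I 1"
abbreviation mvxi (\<open>\<^bold>\<xi>\<close>) where "\<^bold>\<xi> \<equiv> FVar_C 0"
abbreviation mvchi (\<open>\<^bold>\<chi>\<close>) where "\<^bold>\<chi> \<equiv> FVar_C 1"

definition identity_and_cut_rules :: "rule set" where
  "identity_and_cut_rules =
     (\<Union>n. {[] \<Longrightarrow>\<^sub>R fD (PVar n) \<turnstile>\<^sub>D fD (PVar n)}) \<union>
     {[\<^bold>X \<turnstile>\<^sub>D fD \<^bold>A, fD \<^bold>A \<turnstile>\<^sub>D \<^bold>Y] \<Longrightarrow>\<^sub>R \<^bold>X \<turnstile>\<^sub>D \<^bold>Y,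
      [\<^bold>\<Gamma> \<turnstile>\<^sub>I fI \<^bold>\<alpha>, fI \<^bold>\<alpha> \<turnstile>\<^sub>I \<^bold>\<Delta>] \<Longrightarrow>\<^sub>R \<^bold>\<Gamma> \<turnstile>\<^sub>I \<^bold>\<Delta>,
      [\<^bold>\<Pi> \<turnstile>\<^sub>C fC \<^bold>\<xi>, fC \<^bold>\<xi> \<turnstile>\<^sub>C \<^bold>\<Sigma>] \<Longrightarrow>\<^sub>R \<^bold>\<Pi> \<turnstile>\<^sub>C \<^bold>\<Sigma>}"

definition pure_display_rules :: "rule set" where
  "pure_display_rules =
     (\<^bold>X \<and>\<^sub>D \<^bold>Y \<turnstile>\<^sub>D \<^bold>Z \<Longleftrightarrow>\<^sub>R \<^bold>Y \<turnstile>\<^sub>D \<^bold>X \<rightarrow>\<^sub>D \<^bold>Z) \<union>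
     (\<^bold>X \<turnstile>\<^sub>D \<^bold>Y \<or>\<^sub>D \<^bold>Z \<Longleftrightarrow>\<^sub>R \<^bold>Y \<succ>\<^sub>D \<^bold>X \<turnstile>\<^sub>D \<^bold>Z) \<union>
     (tneg \<^bold>X \<turnstile>\<^sub>D \<^bold>Y \<Longleftrightarrow>\<^sub>R tneg \<^bold>Y \<turnstile>\<^sub>D \<^bold>X) \<union>
     (\<^bold>X \<turnstile>\<^sub>D tneg \<^bold>Y \<Longleftrightarrow>\<^sub>R \<^bold>Y \<turnstile>\<^sub>D tneg \<^bold>X) \<union>
     (\<^bold>\<Gamma> \<inter>\<^sub>I \<^bold>\<Delta> \<turnstile>\<^sub>I \<^bold>\<Lambda> \<Longleftrightarrow>\<^sub>R \<^bold>\<Delta> \<turnstile>\<^sub>I \<^bold>\<Gamma> \<rightarrow>\<^sub>I \<^bold>\<Lambda>) \<union>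
     (\<^bold>\<Gamma> \<turnstile>\<^sub>I \<^bold>\<Delta> \<union>\<^sub>I \<^bold>\<Lambda> \<Longleftrightarrow>\<^sub>R \<^bold>\<Delta> \<succ>\<^sub>I \<^bold>\<Gamma> \<turnstile>\<^sub>I \<^bold>\<Lambda>) \<union>
     (\<^bold>\<Pi> \<sqinter>\<^sub>C \<^bold>\<Sigma> \<turnstile>\<^sub>C \<^bold>\<Omega> \<Longleftrightarrow>\<^sub>R \<^bold>\<Sigma> \<turnstile>\<^sub>C \<^bold>\<Pi> \<rightarrow>\<^sub>C \<^bold>\<Omega>) \<union>
     (\<^bold>\<Pi> \<turnstile>\<^sub>C \<^bold>\<Sigma> \<squnion>\<^sub>C \<^bold>\<Omega> \<Longleftrightarrow>\<^sub>R \<^bold>\<Sigma> \<succ>\<^sub>C \<^bold>\<Pi> \<turnstile>\<^sub>C \<^bold>\<Omega>)"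

definition multi_type_display_rules :: "rule set" where
  "multi_type_display_rules =
     (tcirc_I \<^bold>\<Gamma> \<turnstile>\<^sub>D \<^bold>Y \<Longleftrightarrow>\<^sub>R \<^bold>\<Gamma> \<turnstile>\<^sub>I cbbox_I \<^bold>Y) \<union>
     (\<^bold>Y \<turnstile>\<^sub>D tcirc_I \<^bold>\<Gamma> \<Longleftrightarrow>\<^sub>R hbdia_I \<^bold>Y \<turnstile>\<^sub>I \<^bold>\<Gamma>) \<union>
     (\<^bold>Y \<turnstile>\<^sub>D tcirc_C \<^bold>\<Pi> \<Longleftrightarrow>\<^sub>R hbdia_C \<^bold>Y \<turnstile>\<^sub>C \<^bold>\<Pi>) \<union>
     (tcirc_C \<^bold>\<Pi> \<turnstile>\<^sub>D \<^bold>X \<Longleftrightarrow>\<^sub>R \<^bold>\<Pi> \<turnstile>\<^sub>C cbbox_C \<^bold>X)"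

definition pure_structural_rules_D :: "rule set" where
  "pure_structural_rules_D =
     {[\<^bold>X \<turnstile>\<^sub>D \<^bold>Y] \<Longrightarrow>\<^sub>R \<^bold>X \<and>\<^sub>D \<^bold>Z \<turnstile>\<^sub>D \<^bold>Y,
      [\<^bold>X \<turnstile>\<^sub>D \<^bold>Y] \<Longrightarrow>\<^sub>R \<^bold>X \<turnstile>\<^sub>D \<^bold>Y \<or>\<^sub>D \<^bold>Z,
      [\<^bold>X \<and>\<^sub>D \<^bold>X \<turnstile>\<^sub>D \<^bold>Y] \<Longrightarrow>\<^sub>R \<^bold>X \<turnstile>\<^sub>D \<^bold>Y,
      [\<^bold>X \<turnstile>\<^sub>D \<^bold>Y \<or>\<^sub>D \<^bold>Y] \<Longrightarrow>\<^sub>R \<^bold>X \<turnstile>\<^sub>D \<^bold>Y,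
      [\<^bold>X \<and>\<^sub>D \<^bold>Y \<turnstile>\<^sub>D \<^bold>Z] \<Longrightarrow>\<^sub>R \<^bold>Y \<and>\<^sub>D \<^bold>X \<turnstile>\<^sub>D \<^bold>Z,
      [\<^bold>X \<turnstile>\<^sub>D \<^bold>Y \<or>\<^sub>D \<^bold>Z] \<Longrightarrow>\<^sub>R \<^bold>X \<turnstile>\<^sub>D \<^bold>Z \<or>\<^sub>D \<^bold>Y} \<union>
     ((\<^bold>X \<and>\<^sub>D \<^bold>Y) \<and>\<^sub>D \<^bold>Z \<turnstile>\<^sub>D \<^bold>W \<Longleftrightarrow>\<^sub>R \<^bold>X \<and>\<^sub>D (\<^bold>Y \<and>\<^sub>D \<^bold>Z) \<turnstile>\<^sub>D \<^bold>W) \<union>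
     (\<^bold>X \<turnstile>\<^sub>D (\<^bold>Y \<or>\<^sub>D \<^bold>Z) \<or>\<^sub>D \<^bold>W \<Longleftrightarrow>\<^sub>R \<^bold>X \<turnstile>\<^sub>D \<^bold>Y \<or>\<^sub>D (\<^bold>Z \<or>\<^sub>D \<^bold>W)) \<union>
     (\<^bold>X \<turnstile>\<^sub>D \<^bold>Y \<Longleftrightarrow>\<^sub>R tneg \<^bold>Y \<turnstile>\<^sub>D tneg \<^bold>X) \<union>
     (\<^bold>X \<turnstile>\<^sub>D \<^bold>Y \<Longleftrightarrow>\<^sub>R \<^bold>X \<and>\<^sub>D htop \<turnstile>\<^sub>D \<^bold>Y) \<union>
     (\<^bold>X \<turnstile>\<^sub>D \<^bold>Y \<Longleftrightarrow>\<^sub>R \<^bold>X \<turnstile>\<^sub>D \<^bold>Y \<or>\<^sub>D cbot)"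

definition pure_structural_rules_I :: "rule set" where
  "pure_structural_rules_I =
     {[\<^bold>\<Gamma> \<turnstile>\<^sub>I \<^bold>\<Delta>] \<Longrightarrow>\<^sub>R \<^bold>\<Gamma> \<inter>\<^sub>I \<^bold>\<Lambda> \<turnstile>\<^sub>I \<^bold>\<Delta>,
      [\<^bold>\<Gamma> \<turnstile>\<^sub>I \<^bold>\<Delta>] \<Longrightarrow>\<^sub>R \<^bold>\<Gamma> \<turnstile>\<^sub>I \<^bold>\<Delta> \<union>\<^sub>I \<^bold>\<Lambda>,
      [\<^bold>\<Gamma> \<inter>\<^sub>I \<^bold>\<Gamma> \<turnstile>\<^sub>I \<^bold>\<Delta>] \<Longrightarrow>\<^sub>R \<^bold>\<Gamma> \<turnstile>\<^sub>I \<^bold>\<Delta>,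
      [\<^bold>\<Gamma> \<turnstile>\<^sub>I \<^bold>\<Delta> \<union>\<^sub>I \<^bold>\<Delta>] \<Longrightarrow>\<^sub>R \<^bold>\<Gamma> \<turnstile>\<^sub>I \<^bold>\<Delta>,
      [\<^bold>\<Gamma> \<inter>\<^sub>I \<^bold>\<Delta> \<turnstile>\<^sub>I \<^bold>\<Lambda>] \<Longrightarrow>\<^sub>R \<^bold>\<Delta> \<inter>\<^sub>I \<^bold>\<Gamma> \<turnstile>\<^sub>I \<^bold>\<Lambda>,
      [\<^bold>\<Gamma> \<turnstile>\<^sub>I \<^bold>\<Delta> \<union>\<^sub>I \<^bold>\<Lambda>] \<Longrightarrow>\<^sub>R \<^bold>\<Gamma> \<turnstile>\<^sub>I \<^bold>\<Lambda> \<union>\<^sub>I \<^bold>\<Delta>} \<union>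
     ((\<^bold>\<Gamma> \<inter>\<^sub>I \<^bold>\<Delta>) \<inter>\<^sub>I \<^bold>\<Lambda> \<turnstile>\<^sub>I \<^bold>\<Theta> \<Longleftrightarrow>\<^sub>R \<^bold>\<Gamma> \<inter>\<^sub>I (\<^bold>\<Delta> \<inter>\<^sub>I \<^bold>\<Lambda>) \<turnstile>\<^sub>I \<^bold>\<Theta>) \<union>
     (\<^bold>\<Gamma> \<turnstile>\<^sub>I (\<^bold>\<Delta> \<union>\<^sub>I \<^bold>\<Lambda>) \<union>\<^sub>I \<^bold>\<Theta> \<Longleftrightarrow>\<^sub>R \<^bold>\<Gamma> \<turnstile>\<^sub>I \<^bold>\<Delta> \<union>\<^sub>I (\<^bold>\<Lambda> \<union>\<^sub>I \<^bold>\<Theta>)) \<union>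
     (\<^bold>\<Gamma> \<turnstile>\<^sub>I \<^bold>\<Delta> \<Longleftrightarrow>\<^sub>R \<^bold>\<Gamma> \<inter>\<^sub>I hone_I \<turnstile>\<^sub>I \<^bold>\<Delta>) \<union>
     (\<^bold>\<Gamma> \<turnstile>\<^sub>I \<^bold>\<Delta> \<Longleftrightarrow>\<^sub>R \<^bold>\<Gamma> \<turnstile>\<^sub>I \<^bold>\<Delta> \<union>\<^sub>I czero_I)"

definition pure_structural_rules_C :: "rule set" where
  "pure_structural_rules_C =
     {[\<^bold>\<Pi> \<turnstile>\<^sub>C \<^bold>\<Sigma>] \<Longrightarrow>\<^sub>R \<^bold>\<Pi> \<sqinter>\<^sub>C \<^bold>\<Omega> \<turnstile>\<^sub>C \<^bold>\<Sigma>,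
      [\<^bold>\<Pi> \<turnstile>\<^sub>C \<^bold>\<Sigma>] \<Longrightarrow>\<^sub>R \<^bold>\<Pi> \<turnstile>\<^sub>C \<^bold>\<Sigma> \<squnion>\<^sub>C \<^bold>\<Omega>,
      [\<^bold>\<Pi> \<sqinter>\<^sub>C \<^bold>\<Pi> \<turnstile>\<^sub>C \<^bold>\<Sigma>] \<Longrightarrow>\<^sub>R \<^bold>\<Pi> \<turnstile>\<^sub>C \<^bold>\<Sigma>,
      [\<^bold>\<Pi> \<turnstile>\<^sub>C \<^bold>\<Sigma> \<squnion>\<^sub>C \<^bold>\<Sigma>] \<Longrightarrow>\<^sub>R \<^bold>\<Pi> \<turnstile>\<^sub>C \<^bold>\<Sigma>,
      [\<^bold>\<Pi> \<sqinter>\<^sub>C \<^bold>\<Sigma> \<turnstile>\<^sub>C \<^bold>\<Omega>] \<Longrightarrow>\<^sub>R \<^bold>\<Sigma> \<sqinter>\<^sub>C \<^bold>\<Pi> \<turnstile>\<^sub>C \<^bold>\<Omega>,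
      [\<^bold>\<Pi> \<turnstile>\<^sub>C \<^bold>\<Sigma> \<squnion>\<^sub>C \<^bold>\<Omega>] \<Longrightarrow>\<^sub>R \<^bold>\<Pi> \<turnstile>\<^sub>C \<^bold>\<Omega> \<squnion>\<^sub>C \<^bold>\<Sigma>} \<union>
     ((\<^bold>\<Pi> \<sqinter>\<^sub>C \<^bold>\<Sigma>) \<sqinter>\<^sub>C \<^bold>\<Omega> \<turnstile>\<^sub>C \<^bold>\<Psi> \<Longleftrightarrow>\<^sub>R \<^bold>\<Pi> \<sqinter>\<^sub>C (\<^bold>\<Sigma> \<sqinter>\<^sub>C \<^bold>\<Omega>) \<turnstile>\<^sub>C \<^bold>\<Psi>) \<union>
     (\<^bold>\<Pi> \<turnstile>\<^sub>C (\<^bold>\<Sigma> \<squnion>\<^sub>C \<^bold>\<Omega>) \<squnion>\<^sub>C \<^bold>\<Psi> \<Longleftrightarrow>\<^sub>R \<^bold>\<Pi> \<turnstile>\<^sub>C \<^bold>\<Sigma> \<squnion>\<^sub>C (\<^bold>\<Omega> \<squnion>\<^sub>C \<^bold>\<Psi>)) \<union>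
     (\<^bold>\<Pi> \<turnstile>\<^sub>C \<^bold>\<Sigma> \<Longleftrightarrow>\<^sub>R \<^bold>\<Pi> \<sqinter>\<^sub>C hone_C \<turnstile>\<^sub>C \<^bold>\<Sigma>) \<union>
     (\<^bold>\<Pi> \<turnstile>\<^sub>C \<^bold>\<Sigma> \<Longleftrightarrow>\<^sub>R \<^bold>\<Pi> \<turnstile>\<^sub>C \<^bold>\<Sigma> \<squnion>\<^sub>C czero_C)"

definition multi_type_structural_rules :: "rule set" where
  "multi_type_structural_rules =
     (htop \<turnstile>\<^sub>D \<^bold>Y \<Longleftrightarrow>\<^sub>R tcirc_I hone_I \<turnstile>\<^sub>D \<^bold>Y) \<union>
     (\<^bold>\<Gamma> \<turnstile>\<^sub>I cbbox_I cbot \<Longleftrightarrow>\<^sub>R \<^bold>\<Gamma> \<turnstile>\<^sub>I czero_I) \<union>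
     (hbdia_C htop \<turnstile>\<^sub>C \<^bold>\<Pi> \<Longleftrightarrow>\<^sub>R hone_C \<turnstile>\<^sub>C \<^bold>\<Pi>) \<union>
     (\<^bold>X \<turnstile>\<^sub>D cbot \<Longleftrightarrow>\<^sub>R \<^bold>X \<turnstile>\<^sub>D tcirc_C czero_C) \<union>
     (tcirc_I \<^bold>\<Gamma> \<turnstile>\<^sub>D tcirc_I \<^bold>\<Delta> \<Longleftrightarrow>\<^sub>R \<^bold>\<Gamma> \<turnstile>\<^sub>I \<^bold>\<Delta>) \<union>
     (tcirc_C \<^bold>\<Pi> \<turnstile>\<^sub>D tcirc_C \<^bold>\<Sigma> \<Longleftrightarrow>\<^sub>R \<^bold>\<Pi> \<turnstile>\<^sub>C \<^bold>\<Sigma>) \<union>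
     {[hbdia_C \<^bold>X \<turnstile>\<^sub>C cbbox_C \<^bold>Y] \<Longrightarrow>\<^sub>R \<^bold>X \<turnstile>\<^sub>D \<^bold>Y,
      [hbdia_I \<^bold>X \<turnstile>\<^sub>I cbbox_I \<^bold>Y] \<Longrightarrow>\<^sub>R \<^bold>X \<turnstile>\<^sub>D \<^bold>Y} \<union>
     (\<^bold>X \<turnstile>\<^sub>D tcirc_I (cbbox_I (tneg \<^bold>Y)) \<Longleftrightarrow>\<^sub>R \<^bold>X \<turnstile>\<^sub>D tneg (tcirc_C (hbdia_C \<^bold>Y))) \<union>
     (\<^bold>X \<turnstile>\<^sub>D tcirc_C (cbbox_C (tneg \<^bold>Y)) \<Longleftrightarrow>\<^sub>R \<^bold>X \<turnstile>\<^sub>D tneg (tcirc_I (hbdia_I \<^bold>Y))) \<union>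
     (tcirc_C (hbdia_C (tneg \<^bold>X)) \<turnstile>\<^sub>D \<^bold>Y \<Longleftrightarrow>\<^sub>R tneg (tcirc_I (cbbox_I \<^bold>X)) \<turnstile>\<^sub>D \<^bold>Y) \<union>
     (tcirc_I (hbdia_I (tneg \<^bold>X)) \<turnstile>\<^sub>D \<^bold>Y \<Longleftrightarrow>\<^sub>R tneg (tcirc_C (cbbox_C \<^bold>X)) \<turnstile>\<^sub>D \<^bold>Y)"

definition operational_rules_D :: "rule set" where
  "operational_rules_D =
     {[] \<Longrightarrow>\<^sub>R htop \<turnstile>\<^sub>D fD Top_D,
      [htop \<turnstile>\<^sub>D \<^bold>X] \<Longrightarrow>\<^sub>R fD Top_D \<turnstile>\<^sub>D \<^bold>X,
      [] \<Longrightarrow>\<^sub>R fD Bot_D \<turnstile>\<^sub>D cbot,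
      [\<^bold>X \<turnstile>\<^sub>D cbot] \<Longrightarrow>\<^sub>R \<^bold>X \<turnstile>\<^sub>D fD Bot_D,
      [fD \<^bold>A \<and>\<^sub>D fD \<^bold>B \<turnstile>\<^sub>D \<^bold>X] \<Longrightarrow>\<^sub>R fD (And_D \<^bold>A \<^bold>B) \<turnstile>\<^sub>D \<^bold>X,
      [\<^bold>X \<turnstile>\<^sub>D fD \<^bold>A, \<^bold>Y \<turnstile>\<^sub>D fD \<^bold>B] \<Longrightarrow>\<^sub>R \<^bold>X \<and>\<^sub>D \<^bold>Y \<turnstile>\<^sub>D fD (And_D \<^bold>A \<^bold>B),
      [fD \<^bold>A \<turnstile>\<^sub>D \<^bold>X, fD \<^bold>B \<turnstile>\<^sub>D \<^bold>Y] \<Longrightarrow>\<^sub>R fD (Or_D \<^bold>A \<^bold>B) \<turnstile>\<^sub>D \<^bold>X \<or>\<^sub>D \<^bold>Y,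
      [\<^bold>X \<turnstile>\<^sub>D fD \<^bold>A \<or>\<^sub>D fD \<^bold>B] \<Longrightarrow>\<^sub>R \<^bold>X \<turnstile>\<^sub>D fD (Or_D \<^bold>A \<^bold>B),
      [tneg (fD \<^bold>A) \<turnstile>\<^sub>D \<^bold>X] \<Longrightarrow>\<^sub>R fD (Neg_D \<^bold>A) \<turnstile>\<^sub>D \<^bold>X,
      [\<^bold>X \<turnstile>\<^sub>D tneg (fD \<^bold>A)] \<Longrightarrow>\<^sub>R \<^bold>X \<turnstile>\<^sub>D fD (Neg_D \<^bold>A)}"

definition operational_rules_I :: "rule set" where
  "operational_rules_I =
     {[] \<Longrightarrow>\<^sub>R hone_I \<turnstile>\<^sub>I fI One_I,
      [hone_I \<turnstile>\<^sub>I \<^bold>\<Gamma>] \<Longrightarrow>\<^sub>R fI One_I \<turnstile>\<^sub>I \<^bold>\<Gamma>,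
      [] \<Longrightarrow>\<^sub>R fI Zero_I \<turnstile>\<^sub>I czero_I,
      [\<^bold>\<Gamma> \<turnstile>\<^sub>I czero_I] \<Longrightarrow>\<^sub>R \<^bold>\<Gamma> \<turnstile>\<^sub>I fI Zero_I,
      [fI \<^bold>\<alpha> \<inter>\<^sub>I fI \<^bold>\<beta> \<turnstile>\<^sub>I \<^bold>\<Gamma>] \<Longrightarrow>\<^sub>R fI (Cap_I \<^bold>\<alpha> \<^bold>\<beta>) \<turnstile>\<^sub>I \<^bold>\<Gamma>,
      [\<^bold>\<Gamma> \<turnstile>\<^sub>I fI \<^bold>\<alpha>, \<^bold>\<Delta> \<turnstile>\<^sub>I fI \<^bold>\<beta>] \<Longrightarrow>\<^sub>R \<^bold>\<Gamma> \<inter>\<^sub>I \<^bold>\<Delta> \<turnstile>\<^sub>I fI (Cap_I \<^bold>\<alpha> \<^bold>\<beta>),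
      [fI \<^bold>\<alpha> \<turnstile>\<^sub>I \<^bold>\<Gamma>, fI \<^bold>\<beta> \<turnstile>\<^sub>I \<^bold>\<Delta>] \<Longrightarrow>\<^sub>R fI (Cup_I \<^bold>\<alpha> \<^bold>\<beta>) \<turnstile>\<^sub>I \<^bold>\<Gamma> \<union>\<^sub>I \<^bold>\<Delta>,
      [\<^bold>\<Gamma> \<turnstile>\<^sub>I fI \<^bold>\<alpha> \<union>\<^sub>I fI \<^bold>\<beta>] \<Longrightarrow>\<^sub>R \<^bold>\<Gamma> \<turnstile>\<^sub>I fI (Cup_I \<^bold>\<alpha> \<^bold>\<beta>)}"

definition operational_rules_C :: "rule set" where
  "operational_rules_C =
     {[] \<Longrightarrow>\<^sub>R hone_C \<turnstile>\<^sub>C fC One_C,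
      [hone_C \<turnstile>\<^sub>C \<^bold>\<Pi>] \<Longrightarrow>\<^sub>R fC One_C \<turnstile>\<^sub>C \<^bold>\<Pi>,
      [] \<Longrightarrow>\<^sub>R fC Zero_C \<turnstile>\<^sub>C czero_C,
      [\<^bold>\<Pi> \<turnstile>\<^sub>C czero_C] \<Longrightarrow>\<^sub>R \<^bold>\<Pi> \<turnstile>\<^sub>C fC Zero_C,
      [fC \<^bold>\<xi> \<sqinter>\<^sub>C fC \<^bold>\<chi> \<turnstile>\<^sub>C \<^bold>\<Pi>] \<Longrightarrow>\<^sub>R fC (Cap_C \<^bold>\<xi> \<^bold>\<chi>) \<turnstile>\<^sub>C \<^bold>\<Pi>,
      [\<^bold>\<Pi> \<turnstile>\<^sub>C fC \<^bold>\<xi>, \<^bold>\<Sigma> \<turnstile>\<^sub>C fC \<^bold>\<chi>] \<Longrightarrow>\<^sub>R \<^bold>\<Pi> \<sqinter>\<^sub>C \<^bold>\<Sigma> \<turnstile>\<^sub>C fC (Cap_C \<^bold>\<xi> \<^bold>\<chi>),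
      [fC \<^bold>\<xi> \<turnstile>\<^sub>C \<^bold>\<Pi>, fC \<^bold>\<chi> \<turnstile>\<^sub>C \<^bold>\<Sigma>] \<Longrightarrow>\<^sub>R fC (Cup_C \<^bold>\<xi> \<^bold>\<chi>) \<turnstile>\<^sub>C \<^bold>\<Pi> \<squnion>\<^sub>C \<^bold>\<Sigma>,
      [\<^bold>\<Pi> \<turnstile>\<^sub>C fC \<^bold>\<xi> \<squnion>\<^sub>C fC \<^bold>\<chi>] \<Longrightarrow>\<^sub>R \<^bold>\<Pi> \<turnstile>\<^sub>C fC (Cup_C \<^bold>\<xi> \<^bold>\<chi>)}"

definition multi_type_operational_rules :: "rule set" where
  "multi_type_operational_rules =
     {[\<^bold>\<Gamma> \<turnstile>\<^sub>I cbbox_I (fD \<^bold>A)] \<Longrightarrow>\<^sub>R \<^bold>\<Gamma> \<turnstile>\<^sub>I fI (BBox_I \<^bold>A),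
      [fD \<^bold>A \<turnstile>\<^sub>D \<^bold>X] \<Longrightarrow>\<^sub>R fI (BBox_I \<^bold>A) \<turnstile>\<^sub>I cbbox_I \<^bold>X,
      [hbdia_C (fD \<^bold>A) \<turnstile>\<^sub>C \<^bold>\<Pi>] \<Longrightarrow>\<^sub>R fC (BDia_C \<^bold>A) \<turnstile>\<^sub>C \<^bold>\<Pi>,
      [\<^bold>X \<turnstile>\<^sub>D fD \<^bold>A] \<Longrightarrow>\<^sub>R hbdia_C \<^bold>X \<turnstile>\<^sub>C fC (BDia_C \<^bold>A),
      [\<^bold>X \<turnstile>\<^sub>D tcirc_I (fI \<^bold>\<alpha>)] \<Longrightarrow>\<^sub>R \<^bold>X \<turnstile>\<^sub>D fD (Circ_I \<^bold>\<alpha>),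
      [tcirc_I (fI \<^bold>\<alpha>) \<turnstile>\<^sub>D \<^bold>X] \<Longrightarrow>\<^sub>R fD (Circ_I \<^bold>\<alpha>) \<turnstile>\<^sub>D \<^bold>X,
      [\<^bold>X \<turnstile>\<^sub>D tcirc_C (fC \<^bold>\<xi>)] \<Longrightarrow>\<^sub>R \<^bold>X \<turnstile>\<^sub>D fD (Circ_C \<^bold>\<xi>),
      [tcirc_C (fC \<^bold>\<xi>) \<turnstile>\<^sub>D \<^bold>X] \<Longrightarrow>\<^sub>R fD (Circ_C \<^bold>\<xi>) \<turnstile>\<^sub>D \<^bold>X}"

definition rules_TQBA :: "rule set" where
  "rules_TQBA =
     identity_and_cut_rules \<union> pure_display_rules \<union> multi_type_display_rules \<union>
     pure_structural_rules_D \<union> pure_structural_rules_I \<union> pure_structural_rules_C \<union>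
     multi_type_structural_rules \<union>
     operational_rules_D \<union> operational_rules_I \<union> operational_rules_C \<union>
     multi_type_operational_rules"

definition rules_TQBA5 :: "rule set" where
  "rules_TQBA5 = rules_TQBA \<union>
     (tsim \<^bold>\<Gamma> \<turnstile>\<^sub>I \<^bold>\<Delta> \<Longleftrightarrow>\<^sub>R tsim \<^bold>\<Delta> \<turnstile>\<^sub>I \<^bold>\<Gamma>) \<union>
     (\<^bold>\<Gamma> \<turnstile>\<^sub>I tsim \<^bold>\<Delta> \<Longleftrightarrow>\<^sub>R \<^bold>\<Delta> \<turnstile>\<^sub>I tsim \<^bold>\<Gamma>) \<union>
     (tminus \<^bold>\<Pi> \<turnstile>\<^sub>C \<^bold>\<Sigma> \<Longleftrightarrow>\<^sub>R tminus \<^bold>\<Sigma> \<turnstile>\<^sub>C \<^bold>\<Pi>) \<union>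
     (\<^bold>\<Pi> \<turnstile>\<^sub>C tminus \<^bold>\<Sigma> \<Longleftrightarrow>\<^sub>R \<^bold>\<Sigma> \<turnstile>\<^sub>C tminus \<^bold>\<Pi>) \<union>
     (\<^bold>\<Gamma> \<turnstile>\<^sub>I \<^bold>\<Delta> \<Longleftrightarrow>\<^sub>R tsim \<^bold>\<Delta> \<turnstile>\<^sub>I tsim \<^bold>\<Gamma>) \<union>
     (\<^bold>\<Pi> \<turnstile>\<^sub>C \<^bold>\<Sigma> \<Longleftrightarrow>\<^sub>R tminus \<^bold>\<Sigma> \<turnstile>\<^sub>C tminus \<^bold>\<Pi>) \<union>
     (\<^bold>X \<turnstile>\<^sub>D tcirc_I (cbbox_I \<^bold>Y) \<Longleftrightarrow>\<^sub>R \<^bold>X \<turnstile>\<^sub>D tcirc_C (cbbox_C \<^bold>Y)) \<union>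
     {[\<^bold>X \<turnstile>\<^sub>D tcirc_I (tsim \<^bold>\<Gamma>)] \<Longrightarrow>\<^sub>R \<^bold>X \<turnstile>\<^sub>D tneg (tcirc_I \<^bold>\<Gamma>),
      [\<^bold>X \<turnstile>\<^sub>D tcirc_C (tminus \<^bold>\<Pi>)] \<Longrightarrow>\<^sub>R \<^bold>X \<turnstile>\<^sub>D tneg (tcirc_C \<^bold>\<Pi>),
      [\<^bold>\<Gamma> \<turnstile>\<^sub>I tsim (fI \<^bold>\<alpha>)] \<Longrightarrow>\<^sub>R \<^bold>\<Gamma> \<turnstile>\<^sub>I fI (Sim_I \<^bold>\<alpha>),
      [tsim (fI \<^bold>\<alpha>) \<turnstile>\<^sub>I \<^bold>\<Gamma>] \<Longrightarrow>\<^sub>R fI (Sim_I \<^bold>\<alpha>) \<turnstile>\<^sub>I \<^bold>\<Gamma>,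
      [\<^bold>\<Pi> \<turnstile>\<^sub>C tminus (fC \<^bold>\<xi>)] \<Longrightarrow>\<^sub>R \<^bold>\<Pi> \<turnstile>\<^sub>C fC (Minus_C \<^bold>\<xi>),
      [tminus (fC \<^bold>\<xi>) \<turnstile>\<^sub>C \<^bold>\<Pi>] \<Longrightarrow>\<^sub>R fC (Minus_C \<^bold>\<xi>) \<turnstile>\<^sub>C \<^bold>\<Pi>}"

definition rules_IA1 :: "rule set" where
  "rules_IA1 = rules_TQBA5 \<union>
     {[\<^bold>\<Gamma> \<inter>\<^sub>I \<^bold>\<Delta> \<turnstile>\<^sub>I \<^bold>\<Lambda>] \<Longrightarrow>\<^sub>R \<^bold>\<Delta> \<turnstile>\<^sub>I tsim \<^bold>\<Gamma> \<union>\<^sub>I \<^bold>\<Lambda>,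
      [\<^bold>\<Pi> \<sqinter>\<^sub>C \<^bold>\<Sigma> \<turnstile>\<^sub>C \<^bold>\<Omega>] \<Longrightarrow>\<^sub>R \<^bold>\<Sigma> \<turnstile>\<^sub>C tminus \<^bold>\<Pi> \<squnion>\<^sub>C \<^bold>\<Omega>}"

definition rules_IA2 :: "rule set" where
  "rules_IA2 = rules_TQBA5 \<union>
     {[\<^bold>\<Gamma> \<turnstile>\<^sub>I cbbox_I (\<^bold>X \<or>\<^sub>D \<^bold>Y)] \<Longrightarrow>\<^sub>R \<^bold>\<Gamma> \<turnstile>\<^sub>I cbbox_I \<^bold>X \<union>\<^sub>I cbbox_I \<^bold>Y,
      [hbdia_C (\<^bold>X \<and>\<^sub>D \<^bold>Y) \<turnstile>\<^sub>C \<^bold>\<Pi>] \<Longrightarrow>\<^sub>R hbdia_C \<^bold>X \<sqinter>\<^sub>C hbdia_C \<^bold>Y \<turnstile>\<^sub>C \<^bold>\<Pi>}"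

definition rules_IA3 :: "rule set" where
  "rules_IA3 = rules_TQBA5 \<union>
     {[\<^bold>X \<turnstile>\<^sub>D \<^bold>Y, \<^bold>W \<turnstile>\<^sub>D \<^bold>Z] \<Longrightarrow>\<^sub>R
        \<^bold>X \<and>\<^sub>D tcirc_C (hbdia_C \<^bold>W) \<turnstile>\<^sub>D tcirc_I (cbbox_I \<^bold>Y) \<or>\<^sub>D \<^bold>Z}"

definition rules_PRA :: "rule set" where
  "rules_PRA = rules_IA1 \<union> rules_IA2 \<union> rules_IA3"

end

theory Submission
  imports Defs
begin

text \<open>
  Once the residuals and the adjoints are known to satisfy the equivalences that are meant to define
  them, the value of a sequent is an inequality in the operations of the algebra, and almost every
  rule becomes a lattice law, one of these equivalences, or a clause of the definition of the
  algebra. Perfection is used only for this existence question: a map out of a complete lattice has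
  a left adjoint as soon as it preserves arbitrary meets, and a right adjoint as soon as it preserves
  arbitrary joins (\<open>left_adjoint_le_iff\<close>, \<open>le_right_adjoint_iff\<close>). Complete distributivity provides
  this for the maps \<open>(\<sqinter>) x\<close> and \<open>(\<squnion>) y\<close>, which gives the residuals, and \<open>perfect_map\<close> provides it
  for the embeddings, which gives \<open>\<iota>'\<close> and \<open>\<gamma>'\<close>.

  A few rules need an argument of their own.

  The structural rules relating \<open>\<not>\<close>, \<open>e\<^sub>C \<gamma>'\<close> and \<open>e\<^sub>I \<iota>'\<close> rest on a counterpart, for these adjoints, of
  the identity \<open>e\<^sub>C (\<gamma> a) = \<not> e\<^sub>I (\<iota> (\<not> a))\<close>. That identity makes negation exchange the images of \<open>e\<^sub>I\<close>
  and \<open>e\<^sub>C\<close>. Since \<open>e\<^sub>I (\<iota>' a)\<close> is the least element of the first image above \<open>a\<close>, and \<open>e\<^sub>C (\<gamma>' (\<not> a))\<close>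
  the greatest element of the second below \<open>\<not> a\<close>, negation also exchanges these two
  (\<open>neg_emb_I_iota'\<close>).

  When the two embeddings coincide, \<open>\<gamma>'\<close> and \<open>\<iota>\<close> are right adjoints of the same map and hence equal,
  which is the structural rule of D.TQBA5 relating the two boxes. The rules of D.IA1 are the usual
  passage of a Boolean complement across an inequality. The second rule of D.IA2 says that \<open>\<gamma>\<close>
  preserves binary meets, which is \<open>H9\<close> conjugated by negation (\<open>gamma_inf\<close>). The rule of D.IA3 is
  an inequality that \<open>H10\<close> allows one to check separately under \<open>\<iota>\<close> and under \<open>\<gamma>\<close>
  (\<open>ia3_inequality\<close>).
\<close>

section \<open>Adjoints and residuals in complete lattices\<close>

text \<open>
  The candidate for the left adjoint is \<open>a \<mapsto> \<Sqinter>{\<beta>. a \<le> e \<beta>}\<close>; preservation of this meet makes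
  \<open>a \<le> e (\<Sqinter>{\<beta>. a \<le> e \<beta>})\<close>.
\<close>

lemma left_adjoint_le_iff:
  fixes e :: "'b::complete_lattice \<Rightarrow> 'a::complete_lattice"
  assumes "completely_meet_pres e"
  shows "left_adjoint e a \<le> \<beta> \<longleftrightarrow> a \<le> e \<beta>"
proof -
  define f where "f a = \<Sqinter>{\<beta>. a \<le> e \<beta>}" for a
  have e_Inf: "e (\<Sqinter>S) = \<Sqinter>(e ` S)" for S
    using assms by (simp add: completely_meet_pres_def)
  have "mono e"
  proof (rule monoI)
    fix x y :: 'b
    assume "x \<le> y"
    then show "e x \<le> e y"
      using e_Inf[of "{x, y}"] by (simp add: inf.absorb1 le_iff_inf)
  qed
  have unit: "a \<le> e (f a)" for a
    unfolding f_def e_Inf by (auto intro: Inf_greatest)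
  have f: "\<forall>a \<beta>. f a \<le> \<beta> \<longleftrightarrow> a \<le> e \<beta>"
  proof (intro allI iffI)
    fix a \<beta>
    assume "f a \<le> \<beta>"
    then show "a \<le> e \<beta>"
      using unit[of a] monoD[OF \<open>mono e\<close>] order_trans by blast
  next
    fix a \<beta>
    assume "a \<le> e \<beta>"
    then show "f a \<le> \<beta>"
      unfolding f_def by (auto intro: Inf_lower)
  qed
  have "\<exists>!f. \<forall>a \<beta>. f a \<le> \<beta> \<longleftrightarrow> a \<le> e \<beta>"
  proof (rule ex1I[of _ f])
    fix g
    assume "\<forall>a \<beta>. g a \<le> \<beta> \<longleftrightarrow> a \<le> e \<beta>"
    with f show "g = f"
      by (intro ext antisym) blast+
  qed (fact f)
  from theI'[OF this] show ?thesis
    unfolding left_adjoint_def by blast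
qed

lemma le_right_adjoint_iff:
  fixes e :: "'b::complete_lattice \<Rightarrow> 'a::complete_lattice"
  assumes "completely_join_pres e"
  shows "\<beta> \<le> right_adjoint e a \<longleftrightarrow> e \<beta> \<le> a"
proof -
  define g where "g a = \<Squnion>{\<beta>. e \<beta> \<le> a}" for a
  have e_Sup: "e (\<Squnion>S) = \<Squnion>(e ` S)" for S
    using assms by (simp add: completely_join_pres_def)
  have "mono e"
  proof (rule monoI)
    fix x y :: 'b
    assume "x \<le> y"
    then show "e x \<le> e y"
      using e_Sup[of "{x, y}"] by (simp add: sup.absorb2 le_iff_sup)
  qed
  have counit: "e (g a) \<le> a" for a
    unfolding g_def e_Sup by (auto intro: Sup_least)
  have g: "\<forall>\<beta> a. e \<beta> \<le> a \<longleftrightarrow> \<beta> \<le> g a"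
  proof (intro allI iffI)
    fix a \<beta>
    assume "\<beta> \<le> g a"
    then show "e \<beta> \<le> a"
      using counit[of a] monoD[OF \<open>mono e\<close>] order_trans by blast
  next
    fix a \<beta>
    assume "e \<beta> \<le> a"
    then show "\<beta> \<le> g a"
      unfolding g_def by (auto intro: Sup_upper)
  qed
  have "\<exists>!g. \<forall>\<beta> a. e \<beta> \<le> a \<longleftrightarrow> \<beta> \<le> g a"
  proof (rule ex1I[of _ g])
    fix f
    assume "\<forall>\<beta> a. e \<beta> \<le> a \<longleftrightarrow> \<beta> \<le> f a"
    with g show "f = g"
      by (intro ext antisym) blast+
  qed (fact g)
  from theI'[OF this] show ?thesis
    unfolding right_adjoint_def by blast
qed

text \<open>
  The residual \<open>meet_residual x\<close> is the right adjoint of \<open>(\<sqinter>) x\<close>, which preserves arbitrary joins by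
  distributivity; dually for \<open>join_residual y\<close> and \<open>(\<squnion>) y\<close>.
\<close>

lemma le_meet_residual_iff:
  fixes x y z :: "'a::complete_distrib_lattice"
  shows "y \<le> meet_residual x z \<longleftrightarrow> x \<sqinter> y \<le> z"
proof -
  have "completely_join_pres ((\<sqinter>) x)"
    by (simp add: completely_join_pres_def inf_Sup)
  note adj = le_right_adjoint_iff[OF this]
  have "meet_residual x z = right_adjoint ((\<sqinter>) x) z"
    unfolding meet_residual_def
    by (rule the_equality) (metis adj, metis adj antisym order_refl)
  then show ?thesis
    by (simp add: adj)
qed

lemma join_residual_le_iff:
  fixes x y z :: "'a::complete_distrib_lattice"
  shows "join_residual y x \<le> z \<longleftrightarrow> x \<le> y \<squnion> z"
proof -
  have "completely_meet_pres ((\<squnion>) y)"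
    by (simp add: completely_meet_pres_def sup_Inf)
  note adj = left_adjoint_le_iff[OF this]
  have "join_residual y x = left_adjoint ((\<squnion>) y) x"
    unfolding join_residual_def
    by (rule the_equality) (metis adj, metis adj antisym order_refl)
  then show ?thesis
    by (simp add: adj)
qed

section \<open>De Morgan negations\<close>

context
  fixes n :: "'a::{bounded_lattice,distrib_lattice} \<Rightarrow> 'a"
  assumes n: "de_morgan n"
begin

lemma de_morgan_involutive: "n (n a) = a"
  using n by (simp add: de_morgan_def)

lemma de_morgan_antimono: "n a \<le> n b \<longleftrightarrow> b \<le> a"
  using n unfolding de_morgan_def by metis

lemma de_morgan_le_swap: "n a \<le> b \<longleftrightarrow> n b \<le> a"
  using n unfolding de_morgan_def by metis

lemma de_morgan_le_swap': "a \<le> n b \<longleftrightarrow> b \<le> n a"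
  using n unfolding de_morgan_def by metis

lemma de_morgan_inf: "n (a \<sqinter> b) = n a \<squnion> n b"
proof (rule antisym)
  have "n (n a \<squnion> n b) \<le> a \<sqinter> b"
    by (intro le_infI) (simp_all add: de_morgan_le_swap[of _ a] de_morgan_le_swap[of _ b])
  then show "n (a \<sqinter> b) \<le> n a \<squnion> n b"
    by (simp only: de_morgan_le_swap[of "a \<sqinter> b"])
  show "n a \<squnion> n b \<le> n (a \<sqinter> b)"
    by (simp add: de_morgan_antimono)
qed

lemma de_morgan_sup: "n (a \<squnion> b) = n a \<sqinter> n b"
  using arg_cong[OF de_morgan_inf[of "n a" "n b"], of n] by (simp add: de_morgan_involutive)

end

section \<open>Perfect heterogeneous algebras\<close>

locale perfect_htqBa =
  fixes H :: "('d::complete_distrib_lattice, 'i::complete_distrib_lattice,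
    'c::complete_distrib_lattice) halg"
  assumes htqBa: "htqBa H" and perfect: "perfect H"
begin

lemma neg_D: "de_morgan (neg_D H)"
  using htqBa by (simp add: htqBa_def)

lemma emb_I: "emb_I H (\<alpha> \<squnion> \<beta>) = emb_I H \<alpha> \<squnion> emb_I H \<beta>"
  "emb_I H (\<alpha> \<sqinter> \<beta>) = emb_I H \<alpha> \<sqinter> emb_I H \<beta>" "emb_I H \<top> = \<top>" "emb_I H \<bottom> = \<bottom>"
  using htqBa by (simp_all add: htqBa_def bounded_lattice_hom_def)

lemma emb_C: "emb_C H (\<xi> \<squnion> \<chi>) = emb_C H \<xi> \<squnion> emb_C H \<chi>"
  "emb_C H (\<xi> \<sqinter> \<chi>) = emb_C H \<xi> \<sqinter> emb_C H \<chi>" "emb_C H \<top> = \<top>" "emb_C H \<bottom> = \<bottom>"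
  using htqBa by (simp_all add: htqBa_def bounded_lattice_hom_def)

lemma iota: "iota H (a \<sqinter> b) = iota H a \<sqinter> iota H b" "iota H \<top> = \<top>" "iota H \<bottom> = \<bottom>"
  using htqBa by (simp_all add: htqBa_def)

lemma gamma: "gamma H (a \<squnion> b) = gamma H a \<squnion> gamma H b" "gamma H \<top> = \<top>" "gamma H \<bottom> = \<bottom>"
  using htqBa by (simp_all add: htqBa_def)

lemma le_iota_iff: "\<alpha> \<le> iota H a \<longleftrightarrow> emb_I H \<alpha> \<le> a"
  using htqBa by (simp add: htqBa_def)

lemma gamma_le_iff: "gamma H a \<le> \<xi> \<longleftrightarrow> a \<le> emb_C H \<xi>"
  using htqBa by (simp add: htqBa_def)

lemma retracts: "iota H (emb_I H \<alpha>) = \<alpha>" "gamma H (emb_C H \<xi>) = \<xi>"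
  using htqBa by (simp_all add: htqBa_def)

lemma emb_C_gamma: "emb_C H (gamma H a) = neg_D H (emb_I H (iota H (neg_D H a)))"
  using htqBa by (simp add: htqBa_def)

lemma iota_mono: "a \<le> b \<Longrightarrow> iota H a \<le> iota H b"
  using le_iota_iff order_trans by blast

lemma gamma_mono: "a \<le> b \<Longrightarrow> gamma H a \<le> gamma H b"
  using gamma_le_iff order_trans by blast

lemma emb_I_le_iff: "emb_I H \<alpha> \<le> emb_I H \<beta> \<longleftrightarrow> \<alpha> \<le> \<beta>"
  by (simp add: retracts flip: le_iota_iff)

lemma emb_C_le_iff: "emb_C H \<xi> \<le> emb_C H \<chi> \<longleftrightarrow> \<xi> \<le> \<chi>"
  by (simp add: retracts flip: gamma_le_iff)

lemma iota'_le_iff: "iota' H a \<le> \<beta> \<longleftrightarrow> a \<le> emb_I H \<beta>"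
proof -
  have "completely_meet_pres (emb_I H)"
    using perfect by (simp add: perfect_def perfect_map_def meet_pres_def emb_I)
  then show ?thesis
    by (simp add: iota'_def left_adjoint_le_iff)
qed

lemma le_gamma'_iff: "\<xi> \<le> gamma' H a \<longleftrightarrow> emb_C H \<xi> \<le> a"
proof -
  have "completely_join_pres (emb_C H)"
    using perfect by (simp add: perfect_def perfect_map_def join_pres_def emb_C)
  then show ?thesis
    by (simp add: gamma'_def le_right_adjoint_iff)
qed

lemma le_emb_I_iota': "a \<le> emb_I H (iota' H a)"
  using iota'_le_iff by blast

lemma emb_C_gamma'_le: "emb_C H (gamma' H a) \<le> a"
  using le_gamma'_iff by blast

lemma emb_I_iota_neg: "emb_I H (iota H (neg_D H a)) = neg_D H (emb_C H (gamma H a))"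
  by (simp add: emb_C_gamma de_morgan_involutive[OF neg_D])

text \<open>
  At an element of the image of one embedding, \<open>emb_C_gamma\<close> exhibits the negation of that element as
  a member of the image of the other.
\<close>

lemma neg_emb_C: "neg_D H (emb_C H \<xi>) = emb_I H (iota H (neg_D H (emb_C H \<xi>)))"
  by (simp add: emb_I_iota_neg retracts)

lemma neg_emb_I: "neg_D H (emb_I H \<alpha>) = emb_C H (gamma H (neg_D H (emb_I H \<alpha>)))"
  by (simp add: emb_C_gamma retracts de_morgan_involutive[OF neg_D])

text \<open>
  The element \<open>\<not> e\<^sub>I (\<iota>' a)\<close> lies below \<open>\<not> a\<close> and in the image of \<open>e\<^sub>C\<close>, hence below the greatest such
  element. Conversely \<open>\<not> e\<^sub>C (\<gamma>' (\<not> a))\<close> lies above \<open>a\<close> and in the image of \<open>e\<^sub>I\<close>, hence above the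
  least such element.
\<close>

lemma neg_emb_I_iota': "neg_D H (emb_I H (iota' H a)) = emb_C H (gamma' H (neg_D H a))"
proof (rule antisym)
  have "neg_D H (emb_I H (iota' H a)) \<le> neg_D H a"
    by (simp add: de_morgan_antimono[OF neg_D] le_emb_I_iota')
  then have "gamma H (neg_D H (emb_I H (iota' H a))) \<le> gamma' H (neg_D H a)"
    by (simp add: le_gamma'_iff flip: neg_emb_I)
  then show "neg_D H (emb_I H (iota' H a)) \<le> emb_C H (gamma' H (neg_D H a))"
    by (simp add: gamma_le_iff)
next
  have "a \<le> neg_D H (emb_C H (gamma' H (neg_D H a)))"
    by (simp add: de_morgan_le_swap'[OF neg_D, of a] emb_C_gamma'_le)
  then have "iota' H a \<le> iota H (neg_D H (emb_C H (gamma' H (neg_D H a))))"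
    by (simp add: iota'_le_iff flip: neg_emb_C)
  then show "emb_C H (gamma' H (neg_D H a)) \<le> neg_D H (emb_I H (iota' H a))"
    by (simp add: le_iota_iff de_morgan_le_swap'[OF neg_D, of "emb_C H _"])
qed

lemma emb_I_iota'_neg: "emb_I H (iota' H (neg_D H a)) = neg_D H (emb_C H (gamma' H a))"
  using arg_cong[OF neg_emb_I_iota'[of "neg_D H a"], of "neg_D H"]
  by (simp add: de_morgan_involutive[OF neg_D])

end

section \<open>Soundness of the rules of D.TQBA\<close>

lemma rule_valid_Rule:
  "rule_valid H (Ss \<Longrightarrow>\<^sub>R S) \<longleftrightarrow> (\<forall>v. (\<forall>S \<in> set Ss. holds H v S) \<longrightarrow> holds H v S)"
  by (simp add: rule_valid_def)

lemma ball_both_rule_valid: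
  "(\<forall>R \<in> S \<Longleftrightarrow>\<^sub>R S'. rule_valid H R) \<longleftrightarrow> (\<forall>v. holds H v S \<longleftrightarrow> holds H v S')"
  by (auto simp: both_def rule_valid_Rule)

lemmas rules_valid_simps = ball_Un ball_both_rule_valid rule_valid_Rule

context perfect_htqBa
begin

lemmas adjunctions =
  le_iota_iff gamma_le_iff iota'_le_iff le_gamma'_iff le_meet_residual_iff join_residual_le_iff

lemma identity_and_cut_rules_valid: "\<forall>R \<in> identity_and_cut_rules. rule_valid H R"
  unfolding identity_and_cut_rules_def by (auto simp: rules_valid_simps)

lemma pure_display_rules_valid: "\<forall>R \<in> pure_display_rules. rule_valid H R"
  unfolding pure_display_rules_def
  \<comment> \<open>The swap laws loop as rewrite rules unless the negated element is pinned to one metavariable.\<close>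
  by (simp add: rules_valid_simps adjunctions de_morgan_le_swap[OF neg_D, of "val_sD _ 0"]
      de_morgan_le_swap'[OF neg_D, of "val_sD _ 0"])

lemma multi_type_display_rules_valid: "\<forall>R \<in> multi_type_display_rules. rule_valid H R"
  unfolding multi_type_display_rules_def by (simp add: rules_valid_simps adjunctions)

lemma pure_structural_rules_valid:
  "\<forall>R \<in> pure_structural_rules_D \<union> pure_structural_rules_I \<union> pure_structural_rules_C. rule_valid H R"
  unfolding pure_structural_rules_D_def pure_structural_rules_I_def pure_structural_rules_C_def
  by (simp add: rules_valid_simps de_morgan_antimono[OF neg_D] ac_simps le_infI1 le_supI1)

lemma multi_type_structural_rules_valid: "\<forall>R \<in> multi_type_structural_rules. rule_valid H R"
proof -
  have "a \<le> b" if "gamma H a \<le> gamma' H b" for a b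
    using that emb_C_gamma'_le[of b] by (auto simp: gamma_le_iff)
  moreover have "a \<le> b" if "iota' H a \<le> iota H b" for a b
    using that le_emb_I_iota'[of a] by (auto simp: le_iota_iff)
  ultimately show ?thesis
    unfolding multi_type_structural_rules_def
    by (simp add: rules_valid_simps emb_I emb_C iota gamma emb_I_le_iff emb_C_le_iff
        emb_I_iota_neg emb_C_gamma[of "neg_D H _"] de_morgan_involutive[OF neg_D]
        emb_I_iota'_neg flip: neg_emb_I_iota')
qed

lemma operational_rules_valid:
  "\<forall>R \<in> operational_rules_D \<union> operational_rules_I \<union> operational_rules_C. rule_valid H R"
  unfolding operational_rules_D_def operational_rules_I_def operational_rules_C_def
  by (simp add: rules_valid_simps le_infI1 le_infI2 le_supI1 le_supI2)

lemma multi_type_operational_rules_valid: "\<forall>R \<in> multi_type_operational_rules. rule_valid H R"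
  unfolding multi_type_operational_rules_def by (simp add: rules_valid_simps iota_mono gamma_mono)

theorem rules_TQBA_valid: "\<forall>R \<in> rules_TQBA. rule_valid H R"
  unfolding rules_TQBA_def ball_Un
  using identity_and_cut_rules_valid pure_display_rules_valid multi_type_display_rules_valid
    pure_structural_rules_valid multi_type_structural_rules_valid operational_rules_valid
    multi_type_operational_rules_valid
  by (auto simp: ball_Un)

end

section \<open>Soundness of the rules of the extensions\<close>

locale perfect_htqBa5 = perfect_htqBa H
  for H :: "('d::complete_distrib_lattice, 'l::complete_distrib_lattice, 'l) halg" +
  assumes H7: "H7 H"
begin

lemma neg_I: "de_morgan (neg_I H)"
  using H7 unfolding H7_def by blast

lemma C_eq_I: "neg_C H = neg_I H" "emb_C H = emb_I H"
  using H7 by (simp_all add: H7_def)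

lemma emb_I_neg_I: "emb_I H (neg_I H \<alpha>) = neg_D H (emb_I H \<alpha>)"
  using H7 unfolding H7_def by blast

text \<open>Both are right adjoints of the common embedding.\<close>

lemma gamma'_eq_iota: "gamma' H a = iota H a"
proof -
  have "\<xi> \<le> gamma' H a \<longleftrightarrow> \<xi> \<le> iota H a" for \<xi>
    by (simp add: le_gamma'_iff le_iota_iff C_eq_I)
  then show ?thesis
    by (blast intro: antisym)
qed

theorem rules_TQBA5_valid: "\<forall>R \<in> rules_TQBA5. rule_valid H R"
  unfolding rules_TQBA5_def
  by (simp add: rules_valid_simps rules_TQBA_valid C_eq_I gamma'_eq_iota emb_I_neg_I
      de_morgan_antimono[OF neg_I]
      de_morgan_le_swap[OF neg_I, of "val_sI _ 0"] de_morgan_le_swap'[OF neg_I, of "val_sI _ 0"]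
      de_morgan_le_swap[OF neg_I, of "val_sC _ 0"] de_morgan_le_swap'[OF neg_I, of "val_sC _ 0"])

theorem rules_IA1_valid:
  assumes "H8 H"
  shows "\<forall>R \<in> rules_IA1. rule_valid H R"
proof -
  interpret L: abstract_boolean_algebra "(\<sqinter>)" "(\<squnion>)" "neg_I H" \<bottom> \<top>
    using assms by (simp add: H8_def)
  have "b \<le> neg_I H a \<squnion> c" if "a \<sqinter> b \<le> c" for a b c
  proof -
    have "b = (a \<squnion> neg_I H a) \<sqinter> b"
      by simp
    also have "\<dots> = (a \<sqinter> b) \<squnion> (neg_I H a \<sqinter> b)"
      by (rule inf_sup_distrib2)
    also have "\<dots> \<le> c \<squnion> neg_I H a"
      by (rule sup_mono) (simp_all add: that)
    finally show ?thesis
      by (simp add: sup_commute)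
  qed
  then show ?thesis
    unfolding rules_IA1_def by (simp add: rules_valid_simps rules_TQBA5_valid C_eq_I)
qed

lemma gamma_inf:
  assumes "H9 H"
  shows "gamma H (a \<sqinter> b) = gamma H a \<sqinter> gamma H b"
proof -
  have "iota H (c \<squnion> d) = iota H c \<squnion> iota H d" for c d
    using assms by (simp add: H9_def)
  then have "emb_C H (gamma H (a \<sqinter> b)) = emb_C H (gamma H a \<sqinter> gamma H b)"
    by (simp add: emb_C_gamma emb_C emb_I de_morgan_inf[OF neg_D] de_morgan_sup[OF neg_D])
  then show ?thesis
    by (metis retracts(2))
qed

theorem rules_IA2_valid:
  assumes "H9 H"
  shows "\<forall>R \<in> rules_IA2. rule_valid H R"
  using assms unfolding rules_IA2_def
  by (simp add: rules_valid_simps rules_TQBA5_valid gamma_inf H9_def)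

text \<open>
  By \<open>H10\<close> the inequality may be checked after applying \<open>\<iota>\<close>, where it follows from
  \<open>\<iota> x \<le> \<iota> y = \<iota> (e (\<iota> y))\<close>, and after applying \<open>\<gamma>\<close>, where it follows from \<open>\<gamma> (e (\<gamma> w)) = \<gamma> w \<le> \<gamma> z\<close>.
\<close>

lemma ia3_inequality:
  assumes "H10 H" "x \<le> y" "w \<le> z"
  shows "x \<sqinter> emb_C H (gamma H w) \<le> emb_I H (iota H y) \<squnion> z"
proof -
  let ?l = "x \<sqinter> emb_C H (gamma H w)" and ?r = "emb_I H (iota H y) \<squnion> z"
  have "iota H ?l \<le> iota H y"
    using \<open>x \<le> y\<close> by (intro iota_mono le_infI1)
  also have "\<dots> = iota H (emb_I H (iota H y))"
    by (simp add: retracts)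
  also have "\<dots> \<le> iota H ?r"
    by (simp add: iota_mono)
  finally have "iota H ?l \<le> iota H ?r" .
  moreover have "gamma H ?l \<le> gamma H ?r"
  proof -
    have "gamma H ?l \<le> gamma H (emb_C H (gamma H w))"
      by (simp add: gamma_mono)
    also have "\<dots> = gamma H w"
      by (simp add: retracts)
    also have "\<dots> \<le> gamma H ?r"
      using \<open>w \<le> z\<close> by (intro gamma_mono le_supI2)
    finally show ?thesis .
  qed
  ultimately show ?thesis
    using \<open>H10 H\<close> by (simp add: H10_def)
qed

theorem rules_IA3_valid:
  assumes "H10 H"
  shows "\<forall>R \<in> rules_IA3. rule_valid H R"
  unfolding rules_IA3_def
  by (simp add: rules_valid_simps rules_TQBA5_valid ia3_inequality[OF assms])

end

theorem mainTheorem3: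
  shows "(\<forall>H :: ('d::complete_distrib_lattice, 'i::complete_distrib_lattice,
                'c::complete_distrib_lattice) halg.
            htqBa H \<and> perfect H \<longrightarrow> (\<forall>R \<in> rules_TQBA. rule_valid H R)) \<and>
         (\<forall>H :: ('d, 'l::complete_distrib_lattice, 'l) halg.
            (htqBa5 H \<and> perfect H \<longrightarrow> (\<forall>R \<in> rules_TQBA5. rule_valid H R)) \<and>
            (hIA1 H \<and> perfect H \<longrightarrow> (\<forall>R \<in> rules_IA1. rule_valid H R)) \<and>
            (hIA2 H \<and> perfect H \<longrightarrow> (\<forall>R \<in> rules_IA2. rule_valid H R)) \<and>
            (hIA3 H \<and> perfect H \<longrightarrow> (\<forall>R \<in> rules_IA3. rule_valid H R)) \<and>
            (hpra H \<and> perfect H \<longrightarrow> (\<forall>R \<in> rules_PRA. rule_valid H R)))"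
proof (intro conjI allI impI)
  fix H :: "('d, 'i, 'c) halg"
  assume "htqBa H \<and> perfect H"
  then interpret perfect_htqBa H
    by unfold_locales simp_all
  show "\<forall>R \<in> rules_TQBA. rule_valid H R"
    by (rule rules_TQBA_valid)
next
  fix H :: "('d, 'l, 'l) halg"
  have htqBa5: "perfect_htqBa5 H" if "htqBa H" "perfect H" "H7 H"
    using that by unfold_locales
  note soundness =
    perfect_htqBa5.rules_TQBA5_valid perfect_htqBa5.rules_IA1_valid
    perfect_htqBa5.rules_IA2_valid perfect_htqBa5.rules_IA3_valid
  show "\<forall>R \<in> rules_TQBA5. rule_valid H R" if "htqBa5 H \<and> perfect H"
    using that soundness(1)[OF htqBa5] unfolding htqBa5_def by blast
  show "\<forall>R \<in> rules_IA1. rule_valid H R" if "hIA1 H \<and> perfect H"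
    using that soundness(2)[OF htqBa5] unfolding hIA1_def by blast
  show "\<forall>R \<in> rules_IA2. rule_valid H R" if "hIA2 H \<and> perfect H"
    using that soundness(3)[OF htqBa5] unfolding hIA2_def by blast
  show "\<forall>R \<in> rules_IA3. rule_valid H R" if "hIA3 H \<and> perfect H"
    using that soundness(4)[OF htqBa5] unfolding hIA3_def by blast
  show "\<forall>R \<in> rules_PRA. rule_valid H R" if "hpra H \<and> perfect H"
    using that soundness(2-4)[OF htqBa5] unfolding hpra_def rules_PRA_def ball_Un by blast
qed

end
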